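(* For every countable ordinal $\alpha$ there is a position in the variant of infinite draughts played with the forced-jump rule but without the forced-iterated-jump rule, whose game value, with Red as the open player, is exactly $\alpha$.
   Context: Infinite draughts is played by two players, Black and Red, on the infinite checkerboard $\mathbb{Z}\times\mathbb{Z}$, using only the dark squares (say those $(x,y)$ with $x+y$ even). A position consists of an arbitrary (possibly infinite) placement of pieces on dark squares, each piece being a black or red pawn or king, together with a specification of which player is to move. Black pawns move only on upward diagonals, red pawns only on downward diagonals; kings may move along all four diagonal directions. A simple move moves a piece one diagonal step, in a permitted direction, to an empty square. A jump moves a piece over a diagonally adjacent enemy piece (in a permitted direction) to the empty square immediately beyond; the jumped enemy piece is captured and removed. A single piece may perform several jumps in succession (an iterated jump), which together count as one turn. If a piece performs an infinite iterated jump, then all enemy pieces jumped are removed and the jumping piece itself is also removed from the board. There is no promotion of pawns. A player loses when it is their turn and they have no legal move; the other player then wins. Infinitely long play is a draw. In the variant considered here: the forced-jump rule is in effect (if a player has any jumping move available, the player must make a jumping move), but the forced-iterated-jump rule is not: after making at least one jump, the player may stop the iterated jump at any point, or continue (possibly infinitely). Game values (with respect to a designated "open" player, here Red) are defined by transfinite recursion: (1) a position in which the game is already won for the open player has value $0$; (2) if the game is not yet won and it is the open player's turn, and the open player can move to a position having a value, then the value is $\alpha+1$ where $\alpha$ is the least value of a position reachable in one legal move; (3) if it is the closed player's turn and every position reachable by a legal move has a value, then the value is the supremum of those values; otherwise the value is undefined. *)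

theory Defs
  imports Main "HOL-Library.Countable_Set"
begin

datatype player = Black | Red
datatype kind = Pawn | King

type_synonym square = "int \<times> int"
type_synonym piece = "player \<times> kind"
type_synonym board = "square \<Rightarrow> piece option"
type_synonym position = "board \<times> player"

fun opp :: "player \<Rightarrow> player" where
  "opp Black = Red"
| "opp Red = Black"

definition dark :: "square \<Rightarrow> bool" where
  "dark s \<longleftrightarrow> even (fst s + snd s)"

definition valid_position :: "position \<Rightarrow> bool" where
  "valid_position P \<longleftrightarrow> (\<forall>s. fst P s \<noteq> None \<longrightarrow> dark s)"

definition diag_dirs :: "square set" where
  "diag_dirs = {(1,1), (1,-1), (-1,1), (-1,-1)}"

fun allowed :: "piece \<Rightarrow> square \<Rightarrow> bool" where
  "allowed (Black, Pawn) d \<longleftrightarrow> d \<in> diag_dirs \<and> snd d = 1"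
| "allowed (Red, Pawn) d \<longleftrightarrow> d \<in> diag_dirs \<and> snd d = -1"
| "allowed (_, King) d \<longleftrightarrow> d \<in> diag_dirs"

definition shift :: "square \<Rightarrow> int \<Rightarrow> square \<Rightarrow> square" where
  "shift s k d = (fst s + k * fst d, snd s + k * snd d)"

definition simple_move :: "position \<Rightarrow> position \<Rightarrow> bool" where
  "simple_move P Q \<longleftrightarrow> (\<exists>s p d. fst P s = Some p \<and> fst p = snd P \<and> allowed p d
      \<and> fst P (shift s 1 d) = None
      \<and> Q = ((fst P)(s := None, shift s 1 d := Some p), opp (snd P)))"

text \<open>An (iterated) jump by the piece starting at s with direction sequence ds:
  jpos i is its square after i jumps, jcap i the square jumped over in jump i,
  jboard i the board after i jumps (jumped pieces removed at once).\<close>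
definition jpos :: "square \<Rightarrow> (nat \<Rightarrow> square) \<Rightarrow> nat \<Rightarrow> square" where
  "jpos s ds i = (fst s + 2 * (\<Sum>j<i. fst (ds j)), snd s + 2 * (\<Sum>j<i. snd (ds j)))"

definition jcap :: "square \<Rightarrow> (nat \<Rightarrow> square) \<Rightarrow> nat \<Rightarrow> square" where
  "jcap s ds i = shift (jpos s ds i) 1 (ds i)"

definition jboard :: "board \<Rightarrow> square \<Rightarrow> (nat \<Rightarrow> square) \<Rightarrow> nat \<Rightarrow> board" where
  "jboard b s ds i = (\<lambda>t. if t = jpos s ds i then b s
      else if t = s \<or> t \<in> jcap s ds ` {..<i} then None else b t)"

definition jstep_ok :: "board \<Rightarrow> square \<Rightarrow> (nat \<Rightarrow> square) \<Rightarrow> nat \<Rightarrow> bool" where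
  "jstep_ok b s ds i \<longleftrightarrow> (\<exists>p. b s = Some p \<and> allowed p (ds i)
      \<and> (\<exists>k. jboard b s ds i (jcap s ds i) = Some (opp (fst p), k))
      \<and> jboard b s ds i (jpos s ds (Suc i)) = None)"

text \<open>Finite iterated jump of n \<ge> 1 jumps (may be stopped at any point).\<close>
definition finite_jump :: "position \<Rightarrow> position \<Rightarrow> bool" where
  "finite_jump P Q \<longleftrightarrow> (\<exists>s p ds n. fst P s = Some p \<and> fst p = snd P \<and> n \<ge> 1
      \<and> (\<forall>i<n. jstep_ok (fst P) s ds i)
      \<and> Q = (jboard (fst P) s ds n, opp (snd P)))"

definition infinite_jump :: "position \<Rightarrow> position \<Rightarrow> bool" where
  "infinite_jump P Q \<longleftrightarrow> (\<exists>s p ds. fst P s = Some p \<and> fst p = snd P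
      \<and> (\<forall>i. jstep_ok (fst P) s ds i)
      \<and> Q = ((\<lambda>t. if t = s \<or> t \<in> range (jcap s ds) then None else fst P t), opp (snd P)))"

definition jump_available :: "position \<Rightarrow> bool" where
  "jump_available P \<longleftrightarrow> (\<exists>s p ds. fst P s = Some p \<and> fst p = snd P \<and> jstep_ok (fst P) s ds 0)"

definition legal_move :: "position \<Rightarrow> position \<Rightarrow> bool" where
  "legal_move P Q \<longleftrightarrow> (if jump_available P then finite_jump P Q \<or> infinite_jump P Q
                         else simple_move P Q)"

definition won_for_red :: "position \<Rightarrow> bool" where
  "won_for_red P \<longleftrightarrow> snd P = Black \<and> (\<nexists>Q. legal_move P Q)"

text \<open>Ordinals are represented by well-orders (compared by \<le>o, <o, =o).
  val_le P a: the value of P is defined and \<le> a. It is the least fixed point of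
  clauses (1)-(3): for Red to move, value = (least successor value)+1 \<le> a iff some
  successor has value < a; for Black to move, value = sup of successor values \<le> a
  iff every successor has a value \<le> a.\<close>
inductive val_le :: "position \<Rightarrow> 'b rel \<Rightarrow> bool" where
  won: "Well_order a \<Longrightarrow> won_for_red P \<Longrightarrow> val_le P a"
| red: "Well_order a \<Longrightarrow> snd P = Red \<Longrightarrow> legal_move P Q \<Longrightarrow> val_le Q c \<Longrightarrow> (c, a) \<in> ordLess
        \<Longrightarrow> val_le P a"
| black: "Well_order a \<Longrightarrow> snd P = Black \<Longrightarrow> (\<forall>Q. legal_move P Q \<longrightarrow> val_le Q a)
        \<Longrightarrow> val_le P a"

definition has_value :: "position \<Rightarrow> 'b rel \<Rightarrow> bool" where
  "has_value P a \<longleftrightarrow> val_le P a \<and> (\<forall>c :: 'b rel. val_le P c \<longrightarrow> (a, c) \<in> ordLeq)"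

end

theory Submission
  imports Defs
begin

text \<open>
  Everything on the board is a pawn. One black pawn climbs a full binary tree whose edges are red
  pawns to be jumped; far below, infinitely many immobile black pawns guarantee that Red always has
  a forced jump, so that Red can answer a move without touching the tree.

  Label the root with \<open>\<alpha>\<close>, and let \<open>\<gamma>\<close> list the nonempty initial segments of \<open>\<alpha>\<close>, each of them
  infinitely often. At a node of level \<open>m\<close> the label \<open>\<beta>\<close> is kept along one branch, and becomes
  \<open>\<gamma> m\<close> along the other one if \<open>\<gamma> m < \<beta>\<close>. The red pawn ahead captures the black pawn wherever it
  stops, because the edge just jumped is now empty; the only exception is the first square of the
  second branch in the case \<open>\<gamma> m < \<beta>\<close>, where an extra red pawn blocks the landing square. From
  label \<open>\<beta>\<close> Black can thus stop safely at exactly the labels \<open>\<delta> < \<beta>\<close>, all other stops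
  (and the infinite jumps) have value 1, and by induction the value at a label is the label itself.
\<close>

abbreviation rp :: "piece option" where "rp \<equiv> Some (Red, Pawn)"
abbreviation bp :: "piece option" where "bp \<equiv> Some (Black, Pawn)"

section \<open>Jumps of pawns\<close>

lemma allowed_pawn:
  "allowed (Black, Pawn) d \<longleftrightarrow> d = (1,1) \<or> d = (-1,1)"
  "allowed (Red, Pawn) d \<longleftrightarrow> d = (1,-1) \<or> d = (-1,-1)"
  by (auto simp: diag_dirs_def)

lemma jpos_0 [simp]: "jpos s ds 0 = s"
  by (simp add: jpos_def)

lemma jpos_Suc: "jpos s ds (Suc i) = shift (jpos s ds i) 2 (ds i)"
  by (simp add: jpos_def shift_def algebra_simps)

lemma jboard_0 [simp]: "jboard b s ds 0 = b"
  by (auto simp: jboard_def)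

lemma jpos_cong: "(\<And>j. j < i \<Longrightarrow> ds j = ds' j) \<Longrightarrow> jpos s ds i = jpos s ds' i"
  by (simp add: jpos_def)

lemma jcap_cong: "(\<And>j. j \<le> i \<Longrightarrow> ds j = ds' j) \<Longrightarrow> jcap s ds i = jcap s ds' i"
  using jpos_cong[of i ds ds' s] by (simp add: jcap_def)

text \<open>Lets a direction sequence be redirected at step \<open>n\<close> while the jumps before
  \<open>n\<close> stay legal; paths are extended in this way.\<close>

lemma jstep_ok_cong:
  assumes "\<And>j. j \<le> i \<Longrightarrow> ds j = ds' j"
  shows "jstep_ok b s ds i = jstep_ok b s ds' i"
proof -
  have "jpos s ds i = jpos s ds' i" "jpos s ds (Suc i) = jpos s ds' (Suc i)"
    using assms by (auto intro!: jpos_cong)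
  moreover have c: "jcap s ds j = jcap s ds' j" if "j \<le> i" for j
    using assms that by (auto intro!: jcap_cong)
  moreover have "jcap s ds ` {..<i} = jcap s ds' ` {..<i}"
    using c by (auto intro!: image_cong)
  ultimately show ?thesis
    using assms[of i] by (simp add: jstep_ok_def jboard_def)
qed

lemma jump_available_iff:
  "jump_available (b, c) \<longleftrightarrow> (\<exists>s k d q. b s = Some (c, k) \<and> allowed (c, k) d
     \<and> b (shift s 1 d) = Some (opp c, q) \<and> b (shift s 2 d) = None)"
proof
  assume "jump_available (b, c)"
  then show "\<exists>s k d q. b s = Some (c, k) \<and> allowed (c, k) d
     \<and> b (shift s 1 d) = Some (opp c, q) \<and> b (shift s 2 d) = None"
    unfolding jump_available_def jstep_ok_def by (fastforce simp: jcap_def jpos_Suc)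
next
  assume "\<exists>s k d q. b s = Some (c, k) \<and> allowed (c, k) d
     \<and> b (shift s 1 d) = Some (opp c, q) \<and> b (shift s 2 d) = None"
  then obtain s k d q where "b s = Some (c, k)" "allowed (c, k) d"
     "b (shift s 1 d) = Some (opp c, q)" "b (shift s 2 d) = None" by blast
  then show "jump_available (b, c)"
    unfolding jump_available_def jstep_ok_def
    by (intro exI[of _ s] exI[of _ "(c,k)"] exI[of _ "\<lambda>_. d"]) (simp add: jcap_def jpos_Suc)
qed

lemma single_jump:
  assumes "b s = Some (c, k)" "allowed (c, k) d"
    "b (shift s 1 d) = Some (opp c, q)" "b (shift s 2 d) = None"
  shows "legal_move (b, c) (b(s := None, shift s 1 d := None, shift s 2 d := Some (c, k)), opp c)"
proof -
  have ne: "s \<noteq> shift s 1 d" "s \<noteq> shift s 2 d" using assms by (cases c; force)+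
  have "jump_available (b, c)" unfolding jump_available_iff using assms by blast
  moreover have "finite_jump (b, c) (b(s := None, shift s 1 d := None, shift s 2 d := Some (c, k)), opp c)"
    unfolding finite_jump_def
    using assms ne
    by (intro exI[of _ s] exI[of _ "(c,k)"] exI[of _ "\<lambda>_. d"] exI[of _ 1])
       (auto simp: jstep_ok_def jboard_def jcap_def jpos_Suc fun_eq_iff)
  ultimately show ?thesis by (simp add: legal_move_def)
qed

lemma black_pawn_heights:
  assumes "b s = bp" "\<And>j. j < i \<Longrightarrow> jstep_ok b s ds j"
  shows "snd (jpos s ds i) = snd s + 2 * int i"
    and "j < i \<Longrightarrow> snd (jcap s ds j) = snd s + 2 * int j + 1"
proof -
  have d: "snd (ds j) = 1" if "j < i" for j
    using assms(2)[OF that] assms(1) by (auto simp: jstep_ok_def)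
  have *: "j \<le> i \<Longrightarrow> snd (jpos s ds j) = snd s + 2 * int j" for j
    by (induction j) (auto simp: jpos_Suc shift_def d)
  show "snd (jpos s ds i) = snd s + 2 * int i" by (rule *) simp
  show "j < i \<Longrightarrow> snd (jcap s ds j) = snd s + 2 * int j + 1"
    using *[of j] d[of j] by (simp add: jcap_def shift_def)
qed

text \<open>A black pawn only climbs, so each jump inspects squares above everything changed so far,
  and the original \<open>b\<close> can replace \<open>jboard\<close>.\<close>

lemma jstep_ok_black_pawn:
  assumes "b s = bp" "\<And>j. j < i \<Longrightarrow> jstep_ok b s ds j"
  shows "jstep_ok b s ds i \<longleftrightarrow> allowed (Black, Pawn) (ds i)
    \<and> (\<exists>k. b (jcap s ds i) = Some (Red, k)) \<and> b (jpos s ds (Suc i)) = None"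
proof (cases "allowed (Black, Pawn) (ds i)")
  case True
  note h = black_pawn_heights[OF assms]
  have up: "jboard b s ds i t = b t" if "snd t > snd s + 2 * int i" for t
    using that h by (fastforce simp: jboard_def)
  have "snd (ds i) = 1" using True by (auto simp: diag_dirs_def)
  then have "snd (jcap s ds i) > snd s + 2 * int i" "snd (jpos s ds (Suc i)) > snd s + 2 * int i"
    using h(1) by (auto simp: jcap_def jpos_Suc shift_def)
  then show ?thesis using up assms(1) by (simp add: jstep_ok_def)
qed (use assms(1) in \<open>auto simp: jstep_ok_def\<close>)

section \<open>The binary tree\<close>

text \<open>The two upward jumps of the pawn from \<open>sq x y\<close> increase \<open>x\<close> (over \<open>esq x y\<close>) or \<open>y\<close>
  (over \<open>nsq x y\<close>), so the pawn moves on a grid whose edges are pairwise distinct squares.\<close>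
definition sq :: "int \<Rightarrow> int \<Rightarrow> square" where "sq x y = (2*x - 2*y, 2*x + 2*y)"
definition esq :: "int \<Rightarrow> int \<Rightarrow> square" where "esq x y = (2*x - 2*y + 1, 2*x + 2*y + 1)"
definition nsq :: "int \<Rightarrow> int \<Rightarrow> square" where "nsq x y = (2*x - 2*y - 1, 2*x + 2*y + 1)"

text \<open>The nodes of level \<open>m\<close> are the points with \<open>x\<close> even on the antidiagonal \<open>x + y = 2^m\<close>. The
  children of \<open>(x, y)\<close> are \<open>(2x, 2y)\<close> and \<open>(2x + 2, 2y - 2)\<close>. Up to an initial east step for the
  second child, a path first goes north in its column \<open>c\<close> and then turns east on the line
  \<open>2x + y = 2^(m+1)\<close>, arriving at \<open>x = 2c\<close>; different columns turn in different rows, so these paths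
  are disjoint. Starting with \<open>y \<ge> 4\<close> makes sure that the step after an exit is to the north.\<close>
definition vertex :: "nat \<Rightarrow> int \<Rightarrow> int \<Rightarrow> bool" where
  "vertex m x y \<longleftrightarrow> 2 \<le> m \<and> 0 \<le> x \<and> 4 \<le> y \<and> 2^m \<le> x + y \<and> x + y < 2 * 2^m
     \<and> (if x + y = 2^m then even x else 2*x + y < 2 * 2^m \<or> even y)"
definition east :: "nat \<Rightarrow> int \<Rightarrow> int \<Rightarrow> bool" where
  "east m x y \<longleftrightarrow> vertex m x y \<and> (x + y = 2^m \<or> 2 * 2^m \<le> 2*x + y)"
definition north :: "nat \<Rightarrow> int \<Rightarrow> int \<Rightarrow> bool" where
  "north m x y \<longleftrightarrow> vertex m x y \<and> 2*x + y < 2 * 2^m"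

text \<open>Trading \<open>2^m\<close> for \<open>4 * k\<close> turns the case analyses on vertices
  into linear arithmetic with parity.\<close>

lemma pow_ge2: "2 \<le> m \<Longrightarrow> \<exists>k\<ge>1. (2::int)^m = 4 * k"
proof -
  assume "2 \<le> m"
  then obtain n where "m = n + 2" by (metis le_add_diff_inverse2)
  then show ?thesis by (intro exI[of _ "2^n"]) (simp add: power_add)
qed

text \<open>The half-open dyadic intervals from \<open>2^m\<close> to \<open>2 * 2^m\<close> are
  disjoint, so \<open>x + y\<close> determines the level.\<close>

lemma level_unique:
  assumes "(2::int)^m \<le> s" "s < 2 * 2^m" "2^m' \<le> s" "s < 2 * 2^m'"
  shows "m = m'"
proof -
  have "(2::int)^m < 2^(Suc m')" "(2::int)^m' < 2^(Suc m)" using assms by auto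
  then have "m < Suc m'" "m' < Suc m"
    using power_less_imp_less_exp[of "2::int"] by (metis one_less_numeral_iff semiring_norm(76))+
  then show ?thesis by simp
qed

lemma vertex_unique: "vertex m x y \<Longrightarrow> vertex m' x y \<Longrightarrow> m = m'"
  unfolding vertex_def using level_unique by blast

lemma node_has_both: "vertex m x y \<Longrightarrow> x + y = 2^m \<Longrightarrow> north m x y \<and> east m x y"
  by (auto simp: north_def east_def vertex_def)

lemma not_north_imp_east: "vertex m x y \<Longrightarrow> \<not> north m x y \<Longrightarrow> east m x y"
  by (auto simp: north_def east_def)

text \<open>Parity is the only issue: the turning line \<open>2*x + y = 2 * 2^m\<close> forces an
  even row, and a level can be completed northward only with \<open>x = 0\<close>.\<close>

lemma vertex_north:
  assumes "north m x y"
  shows "vertex (if x + y + 1 = 2 * 2^m then Suc m else m) x (y + 1)"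
proof -
  obtain k where k: "k \<ge> 1" "(2::int)^m = 4 * k"
    using assms pow_ge2[of m] by (auto simp: north_def vertex_def)
  show ?thesis using assms unfolding north_def vertex_def k(2) power_Suc
    by (auto simp: k(2) split: if_splits) presburger+
qed

text \<open>Eastward edges lie in even rows, so a level is completed at the even value
  \<open>x + 1 = 2 * 2^m - y\<close>.\<close>

lemma vertex_east:
  assumes "east m x y"
  shows "vertex (if x + y + 1 = 2 * 2^m then Suc m else m) (x + 1) y"
proof -
  obtain k where k: "k \<ge> 1" "(2::int)^m = 4 * k"
    using assms pow_ge2[of m] by (auto simp: east_def vertex_def)
  show ?thesis using assms unfolding east_def vertex_def k(2) power_Suc
    by (auto simp: k(2) split: if_splits) presburger+
qed


lemma sq_simps:
  "esq x y = esq x' y' \<longleftrightarrow> x = x' \<and> y = y'"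
  "nsq x y = nsq x' y' \<longleftrightarrow> x = x' \<and> y = y'"
  "sq x y = sq x' y' \<longleftrightarrow> x = x' \<and> y = y'"
  "esq x y \<noteq> nsq x' y'" "nsq x y \<noteq> esq x' y'"
  "sq x y \<noteq> nsq x' y'" "sq x y \<noteq> esq x' y'" "nsq x y \<noteq> sq x' y'" "esq x y \<noteq> sq x' y'"
  unfolding sq_def esq_def nsq_def prod.inject by presburger+

lemma snd_sq:
  "snd (sq x y) = 2 * (x + y)" "snd (esq x y) = 2 * (x + y) + 1" "snd (nsq x y) = 2 * (x + y) + 1"
  by (simp_all add: sq_def esq_def nsq_def)

lemma shift_sq:
  "shift (sq x y) 1 (1,1) = esq x y" "shift (sq x y) 2 (1,1) = sq (x + 1) y"
  "shift (sq x y) 1 (-1,1) = nsq x y" "shift (sq x y) 2 (-1,1) = sq x (y + 1)"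
  "shift (esq x y) 1 (-1,-1) = sq x y" "shift (esq x y) 2 (-1,-1) = esq (x - 1) y"
  "shift (nsq x y) 1 (1,-1) = sq x y" "shift (nsq x y) 2 (1,-1) = nsq x (y - 1)"
  by (simp_all add: shift_def sq_def esq_def nsq_def)

section \<open>The supply of forced jumps for Red\<close>

text \<open>Each black pawn \<open>(4k, -4)\<close> is walled in by red pawns until one of its two upper neighbours
  captures it.\<close>
definition clock :: "board \<Rightarrow> bool" where
  "clock b \<longleftrightarrow> infinite {k. b (4*k, -4) = bp}
    \<and> (\<forall>k. b (4*k, -4) = bp \<longrightarrow> b (4*k + 1, -3) = rp \<and> b (4*k - 1, -3) = rp
        \<and> b (4*k + 2, -2) = rp \<and> b (4*k - 2, -2) = rp \<and> b (4*k + 1, -5) = None \<and> b (4*k - 1, -5) = None)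
    \<and> (\<forall>a h q. h < 0 \<longrightarrow> b (a, h) = Some (Black, q) \<longrightarrow> q = Pawn \<and> h = -4 \<and> (\<exists>k. a = 4*k))
    \<and> (\<forall>a h c q. h < 0 \<longrightarrow> b (a, h) = Some (c, q) \<longrightarrow> q = Pawn)"

definition clock_hit :: "board \<Rightarrow> int \<Rightarrow> int \<Rightarrow> board" where
  "clock_hit b k e = b((4*k + e, -3) := None, (4*k, -4) := None, (4*k - e, -5) := rp)"

lemma clock_cong:
  assumes "clock b" "\<And>a h. h < 0 \<Longrightarrow> b' (a, h) = b (a, h)"
  shows "clock b'"
  using assms unfolding clock_def by simp

lemma clock_black:
  assumes "clock b" "b t = Some (Black, q)" "snd t < 0"
  shows "q = Pawn \<and> (\<exists>k. t = (4*k, -4))"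
  using assms unfolding clock_def by (cases t) fastforce

lemma clock_pawns: "clock b \<Longrightarrow> b t = Some (c, q) \<Longrightarrow> snd t < 0 \<Longrightarrow> q = Pawn"
  unfolding clock_def by (cases t) auto

lemma clock_hit_upper: "snd t \<ge> 0 \<Longrightarrow> clock_hit b k e t = b t"
  by (auto simp: clock_hit_def)

text \<open>A capture changes only the clock pawn's square and two squares diagonally adjacent to
  it. Clock pawns are four apart, so the surroundings of the others survive.\<close>

lemma clock_clock_hit:
  assumes "clock b" "e = 1 \<or> e = -1"
  shows "clock (clock_hit b k e)"
proof -
  have "{j. clock_hit b k e (4*j, -4) = bp} = {j. b (4*j, -4) = bp} - {k}"
    by (auto simp: clock_hit_def)
  then have inf: "infinite {j. clock_hit b k e (4*j, -4) = bp}"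
    using assms by (simp add: clock_def)
  have intact: "clock_hit b k e (4*j + 1, -3) = rp" "clock_hit b k e (4*j - 1, -3) = rp"
     "clock_hit b k e (4*j + 2, -2) = rp" "clock_hit b k e (4*j - 2, -2) = rp"
     "clock_hit b k e (4*j + 1, -5) = None" "clock_hit b k e (4*j - 1, -5) = None"
    if j: "clock_hit b k e (4*j, -4) = bp" for j
  proof -
    have "j \<noteq> k" "b (4*j, -4) = bp" using j by (auto simp: clock_hit_def split: if_splits)
    moreover have "4*j + 1 \<noteq> 4*k + e" "4*j - 1 \<noteq> 4*k + e" "4*j + 1 \<noteq> 4*k - e" "4*j - 1 \<noteq> 4*k - e"
      using \<open>j \<noteq> k\<close> assms(2) by presburger+
    ultimately show "clock_hit b k e (4*j + 1, -3) = rp" "clock_hit b k e (4*j - 1, -3) = rp"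
     "clock_hit b k e (4*j + 2, -2) = rp" "clock_hit b k e (4*j - 2, -2) = rp"
     "clock_hit b k e (4*j + 1, -5) = None" "clock_hit b k e (4*j - 1, -5) = None"
      using assms(1) by (auto simp: clock_hit_def clock_def)
  qed
  have bl: "q = Pawn \<and> h = -4 \<and> (\<exists>k. a = 4*k)"
    if "h < 0" "clock_hit b k e (a, h) = Some (Black, q)" for a h q
    using that assms(1) by (auto simp: clock_hit_def clock_def split: if_splits)
  have pw: "q = Pawn" if "h < 0" "clock_hit b k e (a, h) = Some (c, q)" for a h c q
  proof (cases "(a, h) = (4*k - e, -5)")
    case True then show ?thesis using that by (simp add: clock_hit_def)
  next
    case False
    then have "b (a, h) = Some (c, q)" using that by (auto simp: clock_hit_def split: if_splits)
    then show ?thesis using that(1) assms(1) unfolding clock_def by blast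
  qed
  show ?thesis unfolding clock_def
    by (intro conjI allI impI) (use inf intact bl pw in blast)+
qed

lemma clock_intact:
  assumes "clock b"
  obtains k where "b (4*k, -4) = bp"
proof -
  have "{k. b (4*k, -4) = bp} \<noteq> {}" using assms infinite_imp_nonempty unfolding clock_def by blast
  then show thesis using that by blast
qed

lemma clock_legal_move:
  assumes "clock b"
  obtains k where "legal_move (b, Red) (clock_hit b k 1, Black)"
proof -
  obtain k where k: "b (4*k, -4) = bp" using clock_intact[OF assms] .
  then have "legal_move (b, Red) (clock_hit b k 1, Black)"
    using single_jump[of b "(4*k + 1, -3)" Red Pawn "(-1,-1)" Pawn] assms
    by (simp add: clock_def clock_hit_def shift_def diag_dirs_def)
  then show thesis by (rule that)
qed

lemma clock_blocked:
  assumes "clock b" and bs: "b s = Some (Black, q)" and "snd s < 0" and d: "allowed (Black, q) d"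
  shows "b (shift s 1 d) = rp \<and> b (shift s 2 d) = rp"
proof -
  obtain k where "s = (4*k, -4)" "q = Pawn" using clock_black[OF assms(1) bs] assms(3) by blast
  then show ?thesis using bs d assms(1) allowed_pawn(1)[of d]
    by (auto simp: clock_def shift_def)
qed

text \<open>Every black piece is then a walled-in clock pawn, which can neither step nor jump. Red's
  wins by capturing the tree pawn and after an infinite jump both end like this.\<close>

lemma clock_won:
  assumes "clock b" "\<And>t q. snd t \<ge> 0 \<Longrightarrow> b t \<noteq> Some (Black, q)"
  shows "won_for_red (b, Black)"
proof -
  have blocked: "b (shift s 1 d) = rp \<and> b (shift s 2 d) = rp"
    if "b s = Some (Black, q)" "allowed (Black, q) d" for s q d
    using clock_blocked[OF assms(1) that(1) _ that(2)] assms(2)[of s q] that(1) by linarith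
  have "\<not> jump_available (b, Black)"
    unfolding jump_available_iff using blocked by fastforce
  moreover have "\<not> simple_move (b, Black) Q" for Q
  proof
    assume "simple_move (b, Black) Q"
    then obtain s q d where "b s = Some (Black, q)" "allowed (Black, q) d" "b (shift s 1 d) = None"
      unfolding simple_move_def by auto
    then show False using blocked[of s q d] by simp
  qed
  ultimately show ?thesis by (simp add: won_for_red_def legal_move_def)
qed

text \<open>\<open>E\<close> and \<open>N\<close> disarm the two red pawns that could capture the
  tree pawn. The forced-jump rule excludes simple moves, so Red must capture a clock pawn.\<close>

lemma red_only_clock_moves:
  assumes "clock b"
    and black: "\<And>t q. snd t \<ge> 0 \<Longrightarrow> b t = Some (Black, q) \<Longrightarrow> t = sq x y"
    and red: "\<And>t q. snd t \<ge> 0 \<Longrightarrow> b t = Some (Red, q) \<Longrightarrow> q = Pawn"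
    and E: "b (esq x y) \<noteq> rp \<or> b (esq (x - 1) y) \<noteq> None"
    and N: "b (nsq x y) \<noteq> rp \<or> b (nsq x (y - 1)) \<noteq> None"
    and move: "legal_move (b, Red) Q"
  obtains k e where "e = 1 \<or> e = -1" "Q = (clock_hit b k e, Black)"
proof -
  have pawn: "q = Pawn" if "b t = Some (Red, q)" for t q
    using that red[of t q] clock_pawns[OF assms(1), of t Red q] by force
  have clockblack: "\<exists>k. t = (4*k, -4)" if "b t = Some (Black, q)" "t \<noteq> sq x y" for t q
    using that black[of t q] clock_black[OF assms(1), of t q] by force
  have first: "\<exists>k e. (e = 1 \<or> e = -1) \<and> s = (4*k + e, -3) \<and> ds 0 = (-e, -1)
      \<and> \<not> jstep_ok b s ds 1"
    if sp: "b s = Some p" "fst p = Red" "jstep_ok b s ds 0" for s p ds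
  proof -
    obtain q where q: "p = (Red, q)" using sp(2) by (cases p) auto
    then have p: "p = (Red, Pawn)" using pawn sp by auto
    obtain k where al: "allowed (Red, Pawn) (ds 0)" and cap: "b (shift s 1 (ds 0)) = Some (Black, k)"
      and lan: "b (shift s 2 (ds 0)) = None"
      using sp p by (auto simp: jstep_ok_def jcap_def jpos_Suc)
    then obtain e where e: "e = 1 \<or> e = -1" "ds 0 = (-e, -1)"
      using allowed_pawn(2)[of "ds 0"] by auto
    have "shift s 1 (ds 0) \<noteq> sq x y"
    proof
      assume eq: "shift s 1 (ds 0) = sq x y"
      show False
      proof (cases "e = 1")
        case True
        then have "s = esq x y" "shift s 2 (ds 0) = esq (x - 1) y"
          using eq e by (auto simp: shift_def sq_def esq_def prod_eq_iff)
        then show False using E lan sp p by simp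
      next
        case False
        then have "s = nsq x y" "shift s 2 (ds 0) = nsq x (y - 1)"
          using eq e by (auto simp: shift_def sq_def nsq_def prod_eq_iff)
        then show False using N lan sp p by simp
      qed
    qed
    then obtain j where j: "shift s 1 (ds 0) = (4*j, -4)" using clockblack cap by blast
    then have s: "s = (4*j + e, -3)" using e by (auto simp: shift_def prod_eq_iff)
    \<comment> \<open>A second jump would capture at height -6, but black clock pawns stand at
      height -4 only.\<close>
    have "\<not> jstep_ok b s ds 1"
    proof
      assume ok: "jstep_ok b s ds 1"
      have "allowed (Red, Pawn) (ds 1)" using ok sp p by (auto simp: jstep_ok_def)
      then have "snd (ds 1) = -1" by auto
      then have h: "snd (jcap s ds 1) = -6" using s e by (simp add: jcap_def jpos_def shift_def)
      obtain k' where "jboard b s ds 1 (jcap s ds 1) = Some (Black, k')"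
        using ok sp p by (auto simp: jstep_ok_def)
      moreover have "jcap s ds 1 \<noteq> jpos s ds 1" using h s e by (auto simp: jpos_def)
      ultimately have "b (jcap s ds 1) = Some (Black, k')" by (auto simp: jboard_def split: if_splits)
      from clock_black[OF assms(1) this] h show False by auto
    qed
    then show ?thesis using s e by blast
  qed
  have "jump_available (b, Red)"
  proof -
    obtain k where "b (4*k, -4) = bp" using clock_intact[OF assms(1)] .
    then show ?thesis using assms(1) unfolding jump_available_iff
      by (intro exI[of _ "(4*k + 1, -3)"] exI[of _ Pawn] exI[of _ "(-1,-1)"])
         (simp add: shift_def clock_def diag_dirs_def)
  qed
  with move consider "finite_jump (b, Red) Q" | "infinite_jump (b, Red) Q"
    by (auto simp: legal_move_def)
  then show thesis
  proof cases
    case 1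
    from 1[unfolded finite_jump_def fst_conv snd_conv opp.simps]
    obtain s p ds n where sp: "b s = Some p" "fst p = Red" "n \<ge> 1" "\<forall>i<n. jstep_ok b s ds i"
      "Q = (jboard b s ds n, Black)" by blast
    then obtain k e where ke: "e = 1 \<or> e = -1" "s = (4*k + e, -3)" "ds 0 = (-e, -1)" "\<not> jstep_ok b s ds 1"
      using first[OF sp(1,2), of ds] by fastforce
    have n: "n = 1" using sp(3,4) ke(4) by (metis le_neq_implies_less)
    have "p = (Red, Pawn)" using pawn sp(1,2) by (cases p) auto
    then have bs: "b s = rp" using sp(1) by simp
    have pos: "jpos s ds 1 = (4*k - e, -5)" "jcap s ds 0 = (4*k, -4)"
      using ke by (auto simp: jcap_def jpos_def shift_def)
    have "jboard b s ds 1 = clock_hit b k e"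
      unfolding jboard_def pos clock_hit_def using bs ke(2) pos(2) by (auto simp: fun_eq_iff)
    then have "Q = (clock_hit b k e, Black)" using sp(5) n by simp
    then show thesis using that ke(1) by blast
  next
    case 2
    from 2[unfolded infinite_jump_def fst_conv snd_conv]
    obtain s p ds where "b s = Some p" "fst p = Red" "\<forall>i. jstep_ok b s ds i" by blast
    then show thesis using first[of s p ds] by blast
  qed
qed


section \<open>The tree of initial segments\<close>

lemma ordIso_empty_iff: "(r, r') \<in> ordIso \<Longrightarrow> r = {} \<longleftrightarrow> r' = {}"
proof -
  assume "(r, r') \<in> ordIso"
  then obtain f where "bij_betw f (Field r) (Field r')" unfolding ordIso_def iso_def by blast
  then have "Field r = {} \<longleftrightarrow> Field r' = {}" by (auto simp: bij_betw_def)
  moreover have "q = {} \<longleftrightarrow> Field q = {}" for q :: "'z rel" by (auto simp: Field_def)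
  ultimately show ?thesis by (auto simp: Field_def)
qed

lemma not_ordLess_empty: "(r, {} :: 'c rel) \<notin> ordLess"
proof
  assume r: "(r, {} :: 'c rel) \<in> ordLess"
  then have "Well_order r" by (simp add: ordLess_def)
  then show False using r ordLess_iff_ordIso_Restr[of "{} :: 'c rel" r] by simp
qed

lemma empty_ordLeq: "Well_order r \<Longrightarrow> ({} :: 'c rel, r) \<in> ordLeq"
  using not_ordLeq_iff_ordLess[of r "{} :: 'c rel"] not_ordLess_empty[of r, where ?'c = 'c] by simp

lemma empty_ordLess: "Well_order r \<Longrightarrow> r \<noteq> {} \<Longrightarrow> ({} :: 'c rel, r) \<in> ordLess"
  using empty_ordLeq[of r, where ?'c = 'c] ordIso_empty_iff[of "{} :: 'c rel" r]
  by (auto simp: ordLeq_iff_ordLess_or_ordIso)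

text \<open>Well-orders represent ordinals up to isomorphism, hence \<open>ordIso\<close> in
  \<open>enum\<close>. The bound \<open>N\<close> lets Black find a wanted label above any height
  already reached. Empty orders are excluded because the tree pawn can always move, so no label may
  mean 0.\<close>

locale ordinal_tree =
  fixes \<alpha> :: "'b rel" and \<gamma> :: "nat \<Rightarrow> 'b rel"
  assumes wo_\<alpha>: "Well_order \<alpha>" and ne_\<alpha>: "\<alpha> \<noteq> {}"
    and wo_\<gamma>: "Well_order (\<gamma> m)" and ne_\<gamma>: "\<gamma> m \<noteq> {}"
    and enum: "(c :: 'b rel) \<noteq> {} \<Longrightarrow> (c, \<alpha>) \<in> ordLess \<Longrightarrow> \<exists>m\<ge>N. (\<gamma> m, c) \<in> ordIso"
begin

text \<open>The \<open>x\<close>-coordinate \<open>z\<close> of a node records the branch by which it was reached: \<open>z div 2\<close> is odd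
  exactly after an exit, and the parent is the node \<open>2 * (z div 4)\<close>.\<close>
primrec lab :: "nat \<Rightarrow> int \<Rightarrow> 'b rel" where
  "lab 0 z = \<alpha>"
| "lab (Suc m) z = (if odd (z div 2) \<and> (\<gamma> m, lab m (2 * (z div 4))) \<in> ordLess
     then \<gamma> m else lab m (2 * (z div 4)))"

text \<open>Strictly between two levels, the \<open>min\<close> is the \<open>x\<close>-coordinate of the node at which the path
  through \<open>(x, y)\<close> arrives.\<close>
definition vlab :: "nat \<Rightarrow> int \<Rightarrow> int \<Rightarrow> 'b rel" where
  "vlab m x y = (if x + y = 2^m then lab m x else lab (Suc m) (min (2*x) (2 * 2^m - y)))"

lemma lab_props: "Well_order (lab m z) \<and> lab m z \<noteq> {} \<and> (lab m z, \<alpha>) \<in> ordLeq"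
proof (induction m arbitrary: z)
  case 0 then show ?case using wo_\<alpha> ne_\<alpha> by (simp add: ordLeq_reflexive)
next
  case (Suc m)
  have "(\<gamma> m, \<alpha>) \<in> ordLeq" if "(\<gamma> m, lab m w) \<in> ordLess" for w
    using that Suc[of w] ordLess_imp_ordLeq ordLess_ordLeq_trans by blast
  then show ?case using Suc wo_\<gamma> ne_\<gamma> by auto
qed

lemma vlab_props: "Well_order (vlab m x y)" "vlab m x y \<noteq> {}" "(vlab m x y, \<alpha>) \<in> ordLeq"
  using lab_props by (auto simp: vlab_def simp del: lab.simps)

text \<open>Until the turning line is reached the minimum in \<open>vlab\<close> is
  \<open>2*x\<close>, so a step north does not change the node of arrival; from a node it leads to
  the child that keeps the label.\<close>

lemma vlab_north:
  assumes "north m x y"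
  shows "vlab (if x + y + 1 = 2 * 2^m then Suc m else m) x (y + 1) = vlab m x y"
proof (cases "x + y + 1 = 2 * 2^m")
  case True
  then have "x = 0" "x + y \<noteq> 2^m"
    using assms pow_ge2[of m] by (auto simp: north_def vertex_def)
  then show ?thesis using True by (simp add: vlab_def del: lab.simps)
next
  case F: False
  show ?thesis
  proof (cases "x + y = 2^m")
    case True
    then have "even x" "2*x + y + 1 \<le> 2 * 2^m" using assms by (auto simp: north_def vertex_def)
    then have "lab (Suc m) (2*x) = lab m x" "min (2*x) (2 * 2^m - (y + 1)) = 2*x"
      by (auto simp: algebra_simps elim!: evenE)
    then show ?thesis using True F by (simp add: vlab_def del: lab.simps)
  next
    case False
    have "2*x + y + 1 \<le> 2 * 2^m" using assms by (auto simp: north_def)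
    then have "min (2*x) (2 * 2^m - (y + 1)) = 2*x" "min (2*x) (2 * 2^m - y) = 2*x" by auto
    moreover have "x + (y + 1) \<noteq> 2^m" using assms by (auto simp: north_def vertex_def)
    ultimately show ?thesis using False F by (simp add: vlab_def del: lab.simps)
  qed
qed

text \<open>From the turning line on the minimum is \<open>2 * 2^m - y\<close>, which a step east
  does not change. From a node the step leads to the child \<open>2 * (x + 1)\<close>, whose half is
  odd because \<open>x\<close> is even: this is the exit.\<close>

lemma vlab_east:
  assumes "east m x y"
  shows "vlab (if x + y + 1 = 2 * 2^m then Suc m else m) (x + 1) y =
    (if x + y = 2^m \<and> (\<gamma> m, lab m x) \<in> ordLess then \<gamma> m else vlab m x y)"
proof (cases "x + y = 2^m")
  case True
  obtain k where k: "k \<ge> 1" "(2::int)^m = 4 * k"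
    using assms pow_ge2[of m] by (auto simp: east_def vertex_def)
  have e: "even x" "4 \<le> y" using True assms by (auto simp: east_def vertex_def)
  then have "min (2 * (x + 1)) (2 * 2^m - y) = 2 * (x + 1)" "x + y + 1 \<noteq> 2 * 2^m"
    using True k by auto
  moreover have "(2 * (x + 1)) div 2 = x + 1" "2 * ((2 * (x + 1)) div 4) = x"
    using e(1) by (auto elim!: evenE)
  ultimately show ?thesis using True e(1) by (simp add: vlab_def)
next
  case False
  then have "2 * 2^m \<le> 2*x + y" using assms by (auto simp: east_def)
  then have m: "min (2*x) (2 * 2^m - y) = 2 * 2^m - y" "min (2*(x+1)) (2 * 2^m - y) = 2 * 2^m - y" by auto
  have "x + 1 + y \<noteq> 2^m" using assms by (auto simp: east_def vertex_def)
  then show ?thesis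
  proof (cases "x + y + 1 = 2 * 2^m")
    case True
    then have "x + 1 = 2 * 2^m - y" by simp
    then have "lab (Suc m) (x + 1) = lab (Suc m) (2 * 2^m - y)" by (simp only:)
    then show ?thesis unfolding vlab_def m using True False by (simp del: lab.simps)
  qed (use False m in \<open>simp add: vlab_def del: lab.simps\<close>)
qed

text \<open>The square \<open>nsq x y\<close> lies south of an exit square \<open>(x, y + 1)\<close>. Occupying it prevents the
  northern pawn from capturing there; it adds no path, since \<open>(x, y)\<close> is not a vertex.\<close>
definition dummy :: "int \<Rightarrow> int \<Rightarrow> bool" where
  "dummy x y \<longleftrightarrow> (\<exists>m. vertex m (x - 1) (y + 1) \<and> x + y = 2^m \<and> (\<gamma> m, lab m (x - 1)) \<in> ordLess)"

definition tree_board :: board where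
  "tree_board t = (if (\<exists>m x y. t = esq x y \<and> east m x y) \<or>
     (\<exists>x y. t = nsq x y \<and> ((\<exists>m. north m x y) \<or> dummy x y)) then rp else None)"

lemma tree_board_simps:
  "tree_board (sq x y) = None"
  "tree_board (esq x y) = (if \<exists>m. east m x y then rp else None)"
  "tree_board (nsq x y) = (if (\<exists>m. north m x y) \<or> dummy x y then rp else None)"
  by (auto simp: tree_board_def sq_simps)

lemma tree_board_cases: "tree_board t = None \<or> tree_board t = rp"
  by (auto simp: tree_board_def)

text \<open>A dummy lies beside a node on the same antidiagonal, hence at odd \<open>x\<close>,
  where that antidiagonal has no vertex.\<close>

lemma vertex_not_dummy: "vertex m x y \<Longrightarrow> \<not> dummy x y"
proof
  assume v: "vertex m x y" and "dummy x y"
  then obtain m' where m': "vertex m' (x - 1) (y + 1)" "x + y = 2^m'" unfolding dummy_def by blast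
  then have "m = m'" using v level_unique[of m "x + y" m'] by (auto simp: vertex_def)
  then show False using v m' by (auto simp: vertex_def)
qed

text \<open>An invariant of play: the tree has to be intact only above the pawn, which never
  descends; its lower parts may have lost pieces but gained none.\<close>

definition black_board :: "board \<Rightarrow> int \<Rightarrow> int \<Rightarrow> bool" where
  "black_board b x y \<longleftrightarrow> b (sq x y) = bp \<and> clock b
     \<and> (\<forall>t. snd t > 2 * (x + y) \<longrightarrow> b t = tree_board t)
     \<and> (\<forall>t. 0 \<le> snd t \<and> t \<noteq> sq x y \<longrightarrow> b t = None \<or> b t = tree_board t)"

lemma black_board_above: "black_board b x y \<Longrightarrow> snd t > 2 * (x + y) \<Longrightarrow> b t = tree_board t"
  unfolding black_board_def by blast

lemma black_board_black:
  "black_board b x y \<Longrightarrow> snd t \<ge> 0 \<Longrightarrow> b t = Some (Black, q) \<Longrightarrow> t = sq x y"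
  unfolding black_board_def using tree_board_cases[of t] by fastforce

lemma black_board_red:
  "black_board b x y \<Longrightarrow> snd t \<ge> 0 \<Longrightarrow> b t = Some (Red, q) \<Longrightarrow> q = Pawn"
  unfolding black_board_def using tree_board_cases[of t]
  by (metis Pair_inject option.inject option.simps(3) player.simps(1))

section \<open>Paths of the black pawn in the tree\<close>

lemma pawn_step:
  assumes bb: "black_board b x0 y0" and ok: "\<And>j. j < i \<Longrightarrow> jstep_ok b (sq x0 y0) ds j"
    and pos: "jpos (sq x0 y0) ds i = sq x y" and v: "vertex m x y"
  shows "jstep_ok b (sq x0 y0) ds i \<longleftrightarrow> ds i = (1,1) \<and> east m x y \<or> ds i = (-1,1) \<and> north m x y"
proof -
  have b0: "b (sq x0 y0) = bp" using bb by (simp add: black_board_def)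
  have le: "x0 + y0 \<le> x + y" using black_pawn_heights(1)[of b "sq x0 y0" i ds] b0 ok pos by (simp add: snd_sq)
  have up: "b t = tree_board t" if h: "snd t > 2 * (x + y)" for t
  proof -
    have "snd t > 2 * (x0 + y0)" using h le by presburger
    then show ?thesis using bb unfolding black_board_def by blast
  qed
  have E: "(\<exists>m. east m x y) \<longleftrightarrow> east m x y" and N: "(\<exists>m. north m x y) \<longleftrightarrow> north m x y"
    using v vertex_unique unfolding east_def north_def by blast+
  have step: "jstep_ok b (sq x0 y0) ds i \<longleftrightarrow> allowed (Black, Pawn) (ds i)
    \<and> (\<exists>k. b (jcap (sq x0 y0) ds i) = Some (Red, k)) \<and> b (jpos (sq x0 y0) ds (Suc i)) = None"
    by (rule jstep_ok_black_pawn) (use b0 ok in auto)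
  show ?thesis
    unfolding step jpos_Suc jcap_def pos allowed_pawn
    using vertex_not_dummy[OF v]
    by (auto simp: shift_sq up snd_sq tree_board_simps E N split: if_splits)
qed

text \<open>An edge changes the label only at an exit, where it drops to a smaller
  \<open>\<gamma> m\<close>; so labels never grow along a path.\<close>

lemma pawn_advance:
  assumes bb: "black_board b x0 y0" and ok: "\<And>j. j \<le> i \<Longrightarrow> jstep_ok b (sq x0 y0) ds j"
    and pos: "jpos (sq x0 y0) ds i = sq x y" and v: "vertex m x y"
  obtains x' y' m' where "jpos (sq x0 y0) ds (Suc i) = sq x' y'" "vertex m' x' y'"
    "(vlab m' x' y', vlab m x y) \<in> ordLeq"
proof -
  have "ds i = (1,1) \<and> east m x y \<or> ds i = (-1,1) \<and> north m x y"
    using pawn_step[OF bb _ pos v] ok by simp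
  then show thesis
  proof (elim disjE conjE)
    assume "ds i = (1,1)" and e: "east m x y"
    then have "jpos (sq x0 y0) ds (Suc i) = sq (x + 1) y" by (simp add: jpos_Suc pos shift_sq)
    moreover have "(if x + y = 2^m \<and> (\<gamma> m, lab m x) \<in> ordLess then \<gamma> m else vlab m x y, vlab m x y) \<in> ordLeq"
      using vlab_props(1)[of m x y] by (auto simp: vlab_def ordLess_imp_ordLeq intro: ordLeq_reflexive simp del: lab.simps)
    ultimately show thesis using that[OF _ vertex_east[OF e]] vlab_east[OF e] by simp
  next
    assume "ds i = (-1,1)" and n: "north m x y"
    then have "jpos (sq x0 y0) ds (Suc i) = sq x (y + 1)" by (simp add: jpos_Suc pos shift_sq)
    moreover have "(vlab m x y, vlab m x y) \<in> ordLeq" using vlab_props(1) ordLeq_reflexive by blast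
    ultimately show thesis using that[OF _ vertex_north[OF n]] vlab_north[OF n] by simp
  qed
qed

lemma pawn_path:
  assumes bb: "black_board b x y" and v: "vertex m x y" and ok: "\<And>j. j < n \<Longrightarrow> jstep_ok b (sq x y) ds j"
  obtains x' y' m' where "jpos (sq x y) ds n = sq x' y'" "vertex m' x' y'"
    "(vlab m' x' y', vlab m x y) \<in> ordLeq"
  using ok
proof (induction n arbitrary: thesis)
  case 0
  then show ?case using v vlab_props(1) ordLeq_reflexive by (metis jpos_0)
next
  case (Suc n)
  obtain x1 y1 m1 where 1: "jpos (sq x y) ds n = sq x1 y1" "vertex m1 x1 y1"
    "(vlab m1 x1 y1, vlab m x y) \<in> ordLeq" using Suc by (metis less_Suc_eq)
  obtain x2 y2 m2 where "jpos (sq x y) ds (Suc n) = sq x2 y2" "vertex m2 x2 y2"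
    "(vlab m2 x2 y2, vlab m1 x1 y1) \<in> ordLeq"
    using pawn_advance[OF bb _ 1(1,2)] Suc.prems(2) by (metis less_Suc_eq_le)
  then show ?case using Suc.prems(1) 1(3) ordLeq_transitive by blast
qed


lemma pawn_landing:
  assumes bb: "black_board b x y" and v: "vertex m x y"
    and ok: "\<And>j. j < n \<Longrightarrow> jstep_ok b (sq x y) ds j"
    and pos: "jpos (sq x y) ds n = sq x' y'"
  shows "black_board (jboard b (sq x y) ds n) x' y'"
proof -
  have b0: "b (sq x y) = bp" using bb by (simp add: black_board_def)
  have h: "x' + y' = x + y + int n"
    using black_pawn_heights(1)[of b "sq x y" n ds] b0 ok pos by (simp add: snd_sq)
  have hc: "snd (jcap (sq x y) ds j) = 2 * (x + y) + 2 * int j + 1" if "j < n" for j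
    using black_pawn_heights(2)[of b "sq x y" n ds j] b0 ok that by (simp add: snd_sq)
  have pos0: "x + y \<ge> 4" using v by (simp add: vertex_def)
  \<comment> \<open>All changed squares lie between the start, at positive height, and the landing
    square, so neither the clock nor the tree above is touched.\<close>
  have same: "jboard b (sq x y) ds n t = b t" if "snd t < 0 \<or> snd t > 2 * (x' + y')" for t
  proof -
    have "t \<noteq> sq x' y'" "t \<noteq> sq x y" using that h pos0 by (auto simp: snd_sq)
    moreover have "t \<notin> jcap (sq x y) ds ` {..<n}"
    proof
      assume "t \<in> jcap (sq x y) ds ` {..<n}"
      then obtain j where "j < n" "t = jcap (sq x y) ds j" by blast
      then show False using hc[of j] that h pos0 by auto
    qed
    ultimately show ?thesis by (simp add: jboard_def pos)
  qed
  have "clock (jboard b (sq x y) ds n)"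
    by (rule clock_cong[of b]) (use bb same in \<open>auto simp: black_board_def\<close>)
  moreover have "jboard b (sq x y) ds n (sq x' y') = bp" by (simp add: jboard_def pos b0)
  moreover have "jboard b (sq x y) ds n t = tree_board t" if "snd t > 2 * (x' + y')" for t
  proof -
    have "snd t > 2 * (x + y)" using that h by simp
    then have "b t = tree_board t" using bb unfolding black_board_def by blast
    then show ?thesis using same[of t] that by simp
  qed
  moreover have "jboard b (sq x y) ds n t = None \<or> jboard b (sq x y) ds n t = tree_board t"
    if "0 \<le> snd t" "t \<noteq> sq x' y'" for t
  proof (cases "t = sq x y")
    case False
    then have "b t = None \<or> b t = tree_board t" using bb that unfolding black_board_def by blast
    then show ?thesis using that False by (auto simp: jboard_def pos)
  qed (use that in \<open>simp add: jboard_def pos\<close>)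
  ultimately show ?thesis unfolding black_board_def by blast
qed

lemma pawn_height:
  assumes "black_board b x y" "\<And>j. j < n \<Longrightarrow> jstep_ok b (sq x y) ds j" "jpos (sq x y) ds n = sq x' y'"
  shows "x' + y' = x + y + int n"
  using black_pawn_heights(1)[of b "sq x y" n ds] assms by (simp add: snd_sq black_board_def)

text \<open>Each jump captures in its own layer, so directly below the landing square only the last
  capture is missing. That layer holds the squares on which a red capturer of the pawn would
  land.\<close>

lemma pawn_landing_near:
  assumes bb: "black_board b x y" and ok: "\<And>j. j < Suc n \<Longrightarrow> jstep_ok b (sq x y) ds j"
    and pos: "jpos (sq x y) ds n = sq x1 y1" and t: "snd t = 2 * (x1 + y1) + 1"
  shows "jboard b (sq x y) ds (Suc n) t = (if t = jcap (sq x y) ds n then None else tree_board t)"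
proof -
  have b0: "b (sq x y) = bp" using bb by (simp add: black_board_def)
  have h: "x1 + y1 = x + y + int n" using pawn_height[OF bb _ pos] ok by simp
  have hc: "snd (jcap (sq x y) ds j) = 2 * (x + y) + 2 * int j + 1" if "j < Suc n" for j
    using black_pawn_heights(2)[of b "sq x y" "Suc n" ds j] b0 ok that by (simp add: snd_sq)
  have "t \<in> jcap (sq x y) ds ` {..<Suc n} \<longleftrightarrow> t = jcap (sq x y) ds n"
  proof
    assume "t \<in> jcap (sq x y) ds ` {..<Suc n}"
    then obtain j where j: "j < Suc n" "t = jcap (sq x y) ds j" by blast
    then have "j = n" using hc[of j] t h by simp
    then show "t = jcap (sq x y) ds n" using j by simp
  qed auto
  moreover have "t \<noteq> sq x y" using t h by (auto simp: snd_sq)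
  moreover have "t \<noteq> jpos (sq x y) ds (Suc n)"
    using black_pawn_heights(1)[of b "sq x y" "Suc n" ds] b0 ok t h by (auto simp: snd_sq)
  moreover have "b t = tree_board t"
  proof -
    have "snd t > 2 * (x + y)" using t h by simp
    then show ?thesis using bb unfolding black_board_def by blast
  qed
  ultimately show ?thesis by (simp add: jboard_def)
qed

section \<open>Stopping squares\<close>

definition black_pos :: "position \<Rightarrow> 'b rel \<Rightarrow> bool" where
  "black_pos P \<beta> \<longleftrightarrow> (\<exists>b x y m. P = (b, Black) \<and> black_board b x y \<and> vertex m x y \<and> \<beta> = vlab m x y)"

text \<open>The last two conditions disarm both possible capturers: none stands on
  \<open>esq x y\<close>, and one on \<open>nsq x y\<close> finds its landing square
  occupied.\<close>

definition safe_pos :: "position \<Rightarrow> 'b rel \<Rightarrow> bool" where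
  "safe_pos P \<beta> \<longleftrightarrow> (\<exists>b x y m. P = (b, Red) \<and> black_board b x y \<and> vertex m x y \<and> \<beta> = vlab m x y
     \<and> b (esq x y) = None \<and> b (nsq x (y - 1)) \<noteq> None)"

definition lost_pos :: "position \<Rightarrow> bool" where
  "lost_pos P \<longleftrightarrow> snd P = Red \<and> (\<exists>Q. legal_move P Q \<and> won_for_red Q)"

lemma tree_edges:
  assumes "black_board b x y" "vertex m x y"
  shows "b (esq x y) = (if east m x y then rp else None)" "b (nsq x y) = (if north m x y then rp else None)"
proof -
  have "(\<exists>m. east m x y) \<longleftrightarrow> east m x y" "(\<exists>m. north m x y) \<longleftrightarrow> north m x y"
    using assms(2) vertex_unique unfolding east_def north_def by blast+
  moreover have "b (esq x y) = tree_board (esq x y)" "b (nsq x y) = tree_board (nsq x y)"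
    using black_board_above[OF assms(1)] by (simp_all add: snd_sq)
  ultimately show "b (esq x y) = (if east m x y then rp else None)" "b (nsq x y) = (if north m x y then rp else None)"
    using vertex_not_dummy[OF assms(2)] by (simp_all add: tree_board_simps)
qed

lemma node_exit_north:
  assumes "vertex m x y" "x + y = 2^m"
  shows "vertex m (x + 1) y" "\<not> east m (x + 1) y" "north m (x + 1) y"
proof -
  obtain k where k: "k \<ge> 1" "(2::int)^m = 4 * k"
    using assms pow_ge2[of m] by (auto simp: vertex_def)
  show "vertex m (x + 1) y" "\<not> east m (x + 1) y" "north m (x + 1) y"
    using assms k by (auto simp: vertex_def north_def east_def)
qed

lemma exit_safe:
  assumes bb: "black_board b x y" and v: "vertex m x y"
    and ok: "\<And>j. j < Suc n \<Longrightarrow> jstep_ok b (sq x y) ds j"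
    and pos: "jpos (sq x y) ds n = sq x1 y1" and v1: "vertex m1 x1 y1" and node: "x1 + y1 = 2^m1"
    and d: "ds n = (1,1)" and less: "(\<gamma> m1, lab m1 x1) \<in> ordLess"
  shows "safe_pos (jboard b (sq x y) ds (Suc n), Red) (\<gamma> m1)"
proof -
  let ?b = "jboard b (sq x y) ds (Suc n)"
  have pos2: "jpos (sq x y) ds (Suc n) = sq (x1 + 1) y1" by (simp add: jpos_Suc pos d shift_sq)
  have bb2: "black_board ?b (x1 + 1) y1" using pawn_landing[OF bb v ok pos2] by simp
  note ex = node_exit_north[OF v1 node]
  have "dummy (x1 + 1) (y1 - 1)" unfolding dummy_def using v1 node less
    by (intro exI[of _ m1]) simp
  then have "?b (nsq (x1 + 1) (y1 - 1)) = rp"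
    using pawn_landing_near[OF bb ok pos, of "nsq (x1 + 1) (y1 - 1)"]
    by (simp add: snd_sq jcap_def pos d shift_sq sq_simps tree_board_simps)
  moreover have "?b (esq (x1 + 1) y1) = None" using tree_edges(1)[OF bb2 ex(1)] ex(2) by simp
  moreover have "vlab m1 (x1 + 1) y1 = \<gamma> m1"
  proof -
    have "x1 + y1 + 1 \<noteq> 2 * 2^m1" using ex(1) by (auto simp: vertex_def)
    then show ?thesis using vlab_east[of m1 x1 y1] node_has_both[OF v1 node] node less by simp
  qed
  ultimately show ?thesis unfolding safe_pos_def using bb2 ex(1) by (metis option.distinct(1))
qed

text \<open>The tree pawn is Black's only piece outside the clock, so its capture leaves Black
  without a move.\<close>

lemma captured_lost:
  assumes bb: "black_board b x y" and pos: "x + y \<ge> 4"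
    and cap: "b (esq x y) = rp \<and> b (esq (x - 1) y) = None \<or> b (nsq x y) = rp \<and> b (nsq x (y - 1)) = None"
  shows "lost_pos (b, Red)"
proof -
  have b0: "b (sq x y) = bp" and cl: "clock b" using bb by (auto simp: black_board_def)
  have won: "won_for_red (b(s := None, sq x y := None, t := rp), Black)"
    if "snd s \<ge> 0" "snd t \<ge> 0" for s t
  proof (rule clock_won)
    show "clock (b(s := None, sq x y := None, t := rp))"
      by (rule clock_cong[OF cl]) (use that pos in \<open>auto simp: sq_def\<close>)
    show "(b(s := None, sq x y := None, t := rp)) u \<noteq> Some (Black, q)" if "snd u \<ge> 0" for u q
      using black_board_black[OF bb that, of q] by auto
  qed
  from cap show ?thesis
  proof (elim disjE conjE)
    assume "b (esq x y) = rp" "b (esq (x - 1) y) = None"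
    then have "legal_move (b, Red) (b(esq x y := None, sq x y := None, esq (x - 1) y := rp), Black)"
      using single_jump[of b "esq x y" Red Pawn "(-1,-1)" Pawn] b0
      by (simp add: shift_sq diag_dirs_def)
    moreover have "won_for_red (b(esq x y := None, sq x y := None, esq (x - 1) y := rp), Black)"
      by (rule won) (use pos in \<open>simp_all add: snd_sq\<close>)
    ultimately show ?thesis unfolding lost_pos_def by auto
  next
    assume "b (nsq x y) = rp" "b (nsq x (y - 1)) = None"
    then have "legal_move (b, Red) (b(nsq x y := None, sq x y := None, nsq x (y - 1) := rp), Black)"
      using single_jump[of b "nsq x y" Red Pawn "(1,-1)" Pawn] b0
      by (simp add: shift_sq diag_dirs_def)
    moreover have "won_for_red (b(nsq x y := None, sq x y := None, nsq x (y - 1) := rp), Black)"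
      by (rule won) (use pos in \<open>simp_all add: snd_sq\<close>)
    ultimately show ?thesis unfolding lost_pos_def by auto
  qed
qed

text \<open>At a turn the eastern pawn captures by landing on \<open>esq (x - 1) (y + 1)\<close>. An
  edge there would start at a node, which parity excludes, or on or beyond the turning line, which
  is not reached since \<open>2*x + y < 2 * 2^m\<close>.\<close>

lemma no_west_edge:
  assumes "north m x y" "vertex m' x (y + 1)" "\<not> north m' x (y + 1)"
  shows "\<not> east m'' (x - 1) (y + 1)"
proof
  assume e: "east m'' (x - 1) (y + 1)"
  then have m'': "m'' = m" using assms(1) level_unique[of m "x + y" m'']
    by (auto simp: east_def north_def vertex_def)
  have "m' = (if x + y + 1 = 2 * 2^m then Suc m else m)"
    using vertex_unique[OF assms(2) vertex_north[OF assms(1)]] .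
  then show False using assms e[unfolded m''] by (auto simp: east_def north_def vertex_def split: if_splits)
qed

text \<open>If an edge continues in the same direction, the red pawn on it captures by landing on
  the square just emptied. At a turn the landing square was empty in the tree from the start; at an
  exit it is occupied exactly when the label drops.\<close>

lemma stop_cases:
  assumes bb: "black_board b x y" and v: "vertex m x y"
    and ok: "\<And>j. j < Suc n \<Longrightarrow> jstep_ok b (sq x y) ds j"
  shows "lost_pos (jboard b (sq x y) ds (Suc n), Red) \<or>
    (\<exists>\<delta>. safe_pos (jboard b (sq x y) ds (Suc n), Red) \<delta> \<and> (\<delta>, vlab m x y) \<in> ordLess)"
proof -
  let ?b = "jboard b (sq x y) ds (Suc n)"
  obtain x1 y1 m1 where 1: "jpos (sq x y) ds n = sq x1 y1" "vertex m1 x1 y1"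
    "(vlab m1 x1 y1, vlab m x y) \<in> ordLeq"
    using pawn_path[OF bb v, of n ds] ok by (metis less_Suc_eq)
  have s4: "x1 + y1 \<ge> 4" using 1(2) by (auto simp: vertex_def)
  note near = pawn_landing_near[OF bb ok 1(1)]
  have "ds n = (1,1) \<and> east m1 x1 y1 \<or> ds n = (-1,1) \<and> north m1 x1 y1"
    using pawn_step[OF bb _ 1(1,2)] ok by simp
  then show ?thesis
  proof (elim disjE conjE)
    assume d: "ds n = (1,1)" and e: "east m1 x1 y1"
    define m2 where "m2 = (if x1 + y1 + 1 = 2 * 2^m1 then Suc m1 else m1)"
    have v2: "vertex m2 (x1 + 1) y1" using vertex_east[OF e] by (simp add: m2_def)
    have "jpos (sq x y) ds (Suc n) = sq (x1 + 1) y1" by (simp add: jpos_Suc 1 d shift_sq)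
    then have bb2: "black_board ?b (x1 + 1) y1" using pawn_landing[OF bb v ok] by simp
    have W: "?b (esq x1 y1) = None"
      using near[of "esq x1 y1"] by (simp add: snd_sq jcap_def 1 d shift_sq)
    show ?thesis
    proof (cases "east m2 (x1 + 1) y1")
      case True
      then have "?b (esq (x1 + 1) y1) = rp" using tree_edges(1)[OF bb2 v2] by simp
      then show ?thesis using captured_lost[OF bb2] W s4 by simp
    next
      case False
      \<comment> \<open>Past the turning line the path runs east up to the next node, where an east
        edge starts too; so an east step with no east edge after it is an exit.\<close>
      have node: "x1 + y1 = 2^m1"
      proof (rule ccontr)
        assume "x1 + y1 \<noteq> 2^m1"
        then have "2 * 2^m1 \<le> 2 * x1 + y1" using e by (simp add: east_def)
        then have "east m2 (x1 + 1) y1" using v2 by (auto simp: east_def m2_def)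
        then show False using False by simp
      qed
      have lab1: "vlab m1 x1 y1 = lab m1 x1" using node by (simp add: vlab_def)
      show ?thesis
      proof (cases "(\<gamma> m1, lab m1 x1) \<in> ordLess")
        case True
        then have "safe_pos (?b, Red) (\<gamma> m1)" using exit_safe[OF bb v ok 1(1,2) node d] by simp
        moreover have "(\<gamma> m1, vlab m x y) \<in> ordLess"
          using True 1(3) lab1 ordLess_ordLeq_trans by metis
        ultimately show ?thesis by blast
      next
        case F: False
        \<comment> \<open>The landing square of the northern pawn carries no north edge and, as the
          label does not drop, no dummy; so that pawn can capture.\<close>
        have "\<not> north m' (x1 + 1) (y1 - 1)" for m'
        proof
          assume n: "north m' (x1 + 1) (y1 - 1)"
          then have "m' = m1" using 1(2) level_unique[of m1 "x1 + y1" m'] by (auto simp: north_def vertex_def)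
          then show False using n node 1(2) by (auto simp: north_def vertex_def)
        qed
        moreover have "\<not> dummy (x1 + 1) (y1 - 1)"
        proof
          assume "dummy (x1 + 1) (y1 - 1)"
          then obtain m' where m': "x1 + y1 = 2^m'" "vertex m' x1 y1" "(\<gamma> m', lab m' x1) \<in> ordLess"
            unfolding dummy_def by auto
          then have "m' = m1" using vertex_unique 1(2) by blast
          then show False using m' F by simp
        qed
        ultimately have "?b (nsq (x1 + 1) (y1 - 1)) = None"
          using near[of "nsq (x1 + 1) (y1 - 1)"] by (simp add: snd_sq tree_board_simps)
        moreover have "?b (nsq (x1 + 1) y1) = rp"
          using tree_edges(2)[OF bb2] node_exit_north[OF 1(2) node] by simp
        ultimately show ?thesis using captured_lost[OF bb2] s4 by simp
      qed
    qed
  next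
    assume d: "ds n = (-1,1)" and no: "north m1 x1 y1"
    define m2 where "m2 = (if x1 + y1 + 1 = 2 * 2^m1 then Suc m1 else m1)"
    have v2: "vertex m2 x1 (y1 + 1)" using vertex_north[OF no] by (simp add: m2_def)
    have "jpos (sq x y) ds (Suc n) = sq x1 (y1 + 1)" by (simp add: jpos_Suc 1 d shift_sq)
    then have bb2: "black_board ?b x1 (y1 + 1)" using pawn_landing[OF bb v ok] by simp
    have S: "?b (nsq x1 y1) = None"
      using near[of "nsq x1 y1"] by (simp add: snd_sq jcap_def 1 d shift_sq)
    show ?thesis
    proof (cases "north m2 x1 (y1 + 1)")
      case True
      then have "?b (nsq x1 (y1 + 1)) = rp" using tree_edges(2)[OF bb2 v2] by simp
      then show ?thesis using captured_lost[OF bb2] S s4 by simp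
    next
      case False
      then have "?b (esq x1 (y1 + 1)) = rp"
        using tree_edges(1)[OF bb2 v2] not_north_imp_east[OF v2] by simp
      moreover have "?b (esq (x1 - 1) (y1 + 1)) = None"
        using near[of "esq (x1 - 1) (y1 + 1)"] no_west_edge[OF no v2 False]
        by (simp add: snd_sq tree_board_simps)
      ultimately show ?thesis using captured_lost[OF bb2] s4 by simp
    qed
  qed
qed


section \<open>Legal moves and their effect on labels\<close>

lemma safe_legal:
  assumes "safe_pos P \<beta>" "legal_move P Q"
  shows "black_pos Q \<beta>"
proof -
  obtain b x y m where b: "P = (b, Red)" "black_board b x y" "vertex m x y" "\<beta> = vlab m x y"
    "b (esq x y) = None" "b (nsq x (y - 1)) \<noteq> None"
    using assms(1) unfolding safe_pos_def by blast
  have cl: "clock b" using b(2) by (simp add: black_board_def)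
  \<comment> \<open>The conditions of \<open>safe_pos\<close> leave Red only captures of clock
    pawns, which affect neither the tree nor the label.\<close>
  obtain k e where ke: "e = 1 \<or> e = -1" "Q = (clock_hit b k e, Black)"
  proof (rule red_only_clock_moves[OF cl])
    show "t = sq x y" if "snd t \<ge> 0" "b t = Some (Black, q)" for t q
      using black_board_black[OF b(2) that] .
    show "q = Pawn" if "snd t \<ge> 0" "b t = Some (Red, q)" for t q
      using black_board_red[OF b(2) that] .
    show "b (esq x y) \<noteq> rp \<or> b (esq (x - 1) y) \<noteq> None" using b by simp
    show "b (nsq x y) \<noteq> rp \<or> b (nsq x (y - 1)) \<noteq> None" using b by simp
    show "legal_move (b, Red) Q" using assms(2) b(1) by simp
  qed blast
  have up: "clock_hit b k e t = b t" if "snd t \<ge> 0" for t using clock_hit_upper[OF that] .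
  have xy: "x + y \<ge> 4" using b(3) by (simp add: vertex_def)
  have "black_board (clock_hit b k e) x y"
    unfolding black_board_def
  proof (intro conjI allI impI)
    show "clock_hit b k e (sq x y) = bp"
      using up[of "sq x y"] xy b(2) by (simp add: snd_sq black_board_def)
    show "clock (clock_hit b k e)" using clock_clock_hit[OF cl ke(1)] .
    show "clock_hit b k e t = tree_board t" if "snd t > 2 * (x + y)" for t
      using up[of t] that xy black_board_above[OF b(2) that] by simp
    show "clock_hit b k e t = None \<or> clock_hit b k e t = tree_board t"
      if "0 \<le> snd t \<and> t \<noteq> sq x y" for t
      using up[of t] that b(2) unfolding black_board_def by metis
  qed
  then show ?thesis using b ke unfolding black_pos_def by blast
qed

lemma safe_has_move: "safe_pos P \<beta> \<Longrightarrow> \<exists>Q. legal_move P Q"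
proof -
  assume "safe_pos P \<beta>"
  then obtain b where "P = (b, Red)" "clock b" unfolding safe_pos_def black_board_def by blast
  then show ?thesis using clock_legal_move[of b] by blast
qed

lemma jump_legal:
  assumes bb: "black_board b x y" and ok: "\<And>j. j < Suc n \<Longrightarrow> jstep_ok b (sq x y) ds j"
  shows "legal_move (b, Black) (jboard b (sq x y) ds (Suc n), Red)"
proof -
  have b0: "b (sq x y) = bp" using bb by (simp add: black_board_def)
  have "jump_available (b, Black)"
    unfolding jump_available_def using b0 ok[of 0]
    by (intro exI[of _ "sq x y"] exI[of _ "(Black, Pawn)"] exI[of _ ds]) simp
  moreover have "finite_jump (b, Black) (jboard b (sq x y) ds (Suc n), Red)"
    unfolding finite_jump_def using b0 ok
    by (intro exI[of _ "sq x y"] exI[of _ "(Black, Pawn)"] exI[of _ ds] exI[of _ "Suc n"]) simp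
  ultimately show ?thesis by (simp add: legal_move_def)
qed

text \<open>Going north whenever possible, and east otherwise, never takes an exit, because every
  node has a north edge. So Black can climb arbitrarily far at a constant label.\<close>

lemma straight_path:
  assumes bb: "black_board b x y" and v: "vertex m x y"
  shows "\<exists>ds x' y' m'. (\<forall>j<n. jstep_ok b (sq x y) ds j) \<and> jpos (sq x y) ds n = sq x' y'
    \<and> vertex m' x' y' \<and> vlab m' x' y' = vlab m x y"
proof (induction n)
  case 0
  then show ?case using v by (intro exI[of _ "\<lambda>_. (1,1)"]) auto
next
  case (Suc n)
  then obtain ds x1 y1 m1 where 1: "\<And>j. j < n \<Longrightarrow> jstep_ok b (sq x y) ds j" "jpos (sq x y) ds n = sq x1 y1"
    "vertex m1 x1 y1" "vlab m1 x1 y1 = vlab m x y" by blast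
  define ds' where "ds' = ds(n := if north m1 x1 y1 then (-1,1) else (1,1))"
  have pos: "jpos (sq x y) ds' n = sq x1 y1"
    using 1(2) jpos_cong[of n ds' ds "sq x y"] by (simp add: ds'_def)
  have ok': "jstep_ok b (sq x y) ds' j" if "j < n" for j
    using 1(1)[OF that] jstep_ok_cong[of j ds' ds b "sq x y"] that by (simp add: ds'_def)
  have "jstep_ok b (sq x y) ds' n"
    using pawn_step[OF bb ok' pos 1(3)] not_north_imp_east[OF 1(3)] by (simp add: ds'_def)
  then have ok: "\<forall>j<Suc n. jstep_ok b (sq x y) ds' j" using ok' less_Suc_eq by auto
  show ?case
  proof (cases "north m1 x1 y1")
    case True
    then have "ds' n = (-1,1)" by (simp add: ds'_def)
    then have "jpos (sq x y) ds' (Suc n) = sq x1 (y1 + 1)" by (simp add: jpos_Suc pos shift_sq)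
    moreover have "vlab (if x1 + y1 + 1 = 2 * 2^m1 then Suc m1 else m1) x1 (y1 + 1) = vlab m x y"
      using vlab_north[OF True] 1(4) by simp
    ultimately show ?thesis using ok vertex_north[OF True] by blast
  next
    case False
    then have e: "east m1 x1 y1" and "x1 + y1 \<noteq> 2^m1"
      using not_north_imp_east node_has_both 1(3) by blast+
    then have "vlab (if x1 + y1 + 1 = 2 * 2^m1 then Suc m1 else m1) (x1 + 1) y1 = vlab m x y"
      using vlab_east[OF e] 1(4) by simp
    moreover have "ds' n = (1,1)" using False by (simp add: ds'_def)
    then have "jpos (sq x y) ds' (Suc n) = sq (x1 + 1) y1" by (simp add: jpos_Suc pos shift_sq)
    ultimately show ?thesis using ok vertex_east[OF e] by blast
  qed
qed

lemma black_has_move: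
  assumes "black_pos P \<beta>"
  shows "\<exists>Q. legal_move P Q \<and> snd Q = Red"
proof -
  obtain b x y m where b: "P = (b, Black)" "black_board b x y" "vertex m x y"
    using assms unfolding black_pos_def by blast
  obtain ds where ok: "\<forall>j<Suc 0. jstep_ok b (sq x y) ds j"
    using straight_path[OF b(2,3), of "Suc 0"] by blast
  then have "legal_move (b, Black) (jboard b (sq x y) ds (Suc 0), Red)"
    using jump_legal[OF b(2), of 0 ds] by blast
  then show ?thesis using b(1) by (metis snd_conv)
qed

text \<open>Black climbs at a constant label to a level \<open>M\<close> at which a copy of
  \<open>\<delta>\<close> is offered, and exits there.\<close>

lemma black_reaches:
  assumes "black_pos P \<beta>" "(\<delta> :: 'b rel) \<noteq> {}" "(\<delta>, \<beta>) \<in> ordLess"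
  shows "\<exists>Q \<delta>'. legal_move P Q \<and> safe_pos Q \<delta>' \<and> (\<delta>', \<delta>) \<in> ordIso"
proof -
  obtain b x y m where b: "P = (b, Black)" "black_board b x y" "vertex m x y" "\<beta> = vlab m x y"
    using assms unfolding black_pos_def by blast
  have "(\<delta>, \<alpha>) \<in> ordLess" using assms(3) b(4) vlab_props(3) ordLess_ordLeq_trans by metis
  then obtain M where M: "M \<ge> nat (x + y)" "(\<gamma> M, \<delta>) \<in> ordIso"
    using enum[OF assms(2), of "nat (x + y)"] by blast
  \<comment> \<open>This puts the antidiagonal of level \<open>M\<close> at or above the pawn;
    \<open>n\<close> counts the jumps up to it, possibly none.\<close>
  have "int M < 2^M" by simp
  then have M2: "x + y \<le> 2^M" using M(1) by linarith
  define n where "n = nat (2^M - (x + y))"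
  obtain ds x1 y1 m1 where 1: "\<forall>j<n. jstep_ok b (sq x y) ds j" "jpos (sq x y) ds n = sq x1 y1"
    "vertex m1 x1 y1" "vlab m1 x1 y1 = vlab m x y" using straight_path[OF b(2,3), of n] by blast
  have sum: "x1 + y1 = 2^M" using pawn_height[OF b(2) _ 1(2)] 1(1) M2 by (simp add: n_def)
  then have m1: "m1 = M" using 1(3) level_unique[of m1 "x1 + y1" M] by (simp add: vertex_def)
  define ds' where "ds' = ds(n := (1,1))"
  have pos: "jpos (sq x y) ds' n = sq x1 y1"
    using 1(2) jpos_cong[of n ds' ds "sq x y"] by (simp add: ds'_def)
  have ok': "jstep_ok b (sq x y) ds' j" if "j < n" for j
    using 1(1) jstep_ok_cong[of j ds' ds b "sq x y"] that by (simp add: ds'_def)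
  have "jstep_ok b (sq x y) ds' n"
    using pawn_step[OF b(2) ok' pos 1(3)] node_has_both[OF 1(3)] sum m1 by (simp add: ds'_def)
  then have ok: "jstep_ok b (sq x y) ds' j" if "j < Suc n" for j using ok' that less_Suc_eq by auto
  have "lab m1 x1 = \<beta>" using 1(4) b(4) sum m1 by (simp add: vlab_def)
  then have "(\<gamma> m1, lab m1 x1) \<in> ordLess" using M(2) m1 assms(3) ordIso_ordLess_trans by metis
  then have "safe_pos (jboard b (sq x y) ds' (Suc n), Red) (\<gamma> m1)"
    using exit_safe[OF b(2,3) ok pos 1(3)] sum m1 by (simp add: ds'_def)
  then show ?thesis using jump_legal[OF b(2) ok] b(1) M(2) m1 by blast
qed

text \<open>The jumping pawn disappears too, so after any clock capture by Red only walled-in black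
  pawns are left.\<close>

lemma infinite_jump_lost:
  assumes bb: "black_board b x y" and v: "vertex m x y" and ok: "\<And>i. jstep_ok b (sq x y) ds i"
  shows "lost_pos ((\<lambda>t. if t = sq x y \<or> t \<in> range (jcap (sq x y) ds) then None else b t), Red)"
proof -
  let ?b = "\<lambda>t. if t = sq x y \<or> t \<in> range (jcap (sq x y) ds) then None else b t"
  have b0: "b (sq x y) = bp" and cl: "clock b" using bb by (auto simp: black_board_def)
  have xy: "x + y \<ge> 4" using v by (simp add: vertex_def)
  have "snd (jcap (sq x y) ds j) = 2 * (x + y) + 2 * int j + 1" for j
    using black_pawn_heights(2)[of b "sq x y" "Suc j" ds j] b0 ok by (simp add: snd_sq)
  then have low: "t \<notin> range (jcap (sq x y) ds)" if "snd t < 0" for t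
    using that xy by force
  have cl2: "clock ?b"
  proof (rule clock_cong[OF cl])
    show "?b (a, h) = b (a, h)" if "h < 0" for a h
      using that low[of "(a, h)"] xy by (auto simp: sq_def)
  qed
  obtain k where k: "legal_move (?b, Red) (clock_hit ?b k 1, Black)" using clock_legal_move[OF cl2] .
  have "won_for_red (clock_hit ?b k 1, Black)"
  proof (rule clock_won)
    show "clock (clock_hit ?b k 1)" using clock_clock_hit[OF cl2] by simp
    show "clock_hit ?b k 1 t \<noteq> Some (Black, q)" if "snd t \<ge> 0" for t q
      using clock_hit_upper[OF that, of ?b k 1] black_board_black[OF bb that, of q] by auto
  qed
  then show ?thesis using k unfolding lost_pos_def by auto
qed

lemma black_legal:
  assumes "black_pos P \<beta>" "legal_move P Q"
  shows "lost_pos Q \<or> (\<exists>\<delta>. safe_pos Q \<delta> \<and> (\<delta>, \<beta>) \<in> ordLess)"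
proof -
  obtain b x y m where b: "P = (b, Black)" "black_board b x y" "vertex m x y" "\<beta> = vlab m x y"
    using assms unfolding black_pos_def by blast
  have cl: "clock b" using b(2) by (simp add: black_board_def)
  have mover: "s = sq x y" if s: "b s = Some p" "fst p = Black" "jstep_ok b s ds 0" for s p ds
  proof (cases "snd s \<ge> 0")
    case True
    then show ?thesis using black_board_black[OF b(2), of s "snd p"] s(1,2) by (cases p) auto
  next
    case False
    have "b s = Some (Black, snd p)" using s(1,2) by (cases p) auto
    moreover have "allowed (Black, snd p) (ds 0)" "b (shift s 2 (ds 0)) = None"
      using s calculation by (auto simp: jstep_ok_def jpos_Suc)
    ultimately show ?thesis using clock_blocked[OF cl, of s "snd p" "ds 0"] False by simp
  qed
  \<comment> \<open>The tree pawn always has a jump, so the forced-jump rule excludes simple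
    moves.\<close>
  obtain ds0 where "\<forall>j<Suc 0. jstep_ok b (sq x y) ds0 j"
    using straight_path[OF b(2,3), of "Suc 0"] by blast
  then have "jump_available (b, Black)"
    unfolding jump_available_def using b(2)
    by (intro exI[of _ "sq x y"] exI[of _ "(Black, Pawn)"] exI[of _ ds0]) (simp add: black_board_def)
  then consider "finite_jump (b, Black) Q" | "infinite_jump (b, Black) Q"
    using assms(2) b(1) by (auto simp: legal_move_def)
  then show ?thesis
  proof cases
    case 1
    from 1[unfolded finite_jump_def fst_conv snd_conv opp.simps]
    obtain s p ds n where sp: "b s = Some p" "fst p = Black" "n \<ge> 1" "\<forall>i<n. jstep_ok b s ds i"
      "Q = (jboard b s ds n, Red)" by blast
    obtain k where k: "n = Suc k" using sp(3) by (cases n) auto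
    have "s = sq x y" using mover[OF sp(1,2), of ds] sp(4) k by simp
    then show ?thesis using stop_cases[OF b(2,3), of k ds] sp(4,5) k b(4) by simp
  next
    case 2
    from 2[unfolded infinite_jump_def fst_conv snd_conv opp.simps]
    obtain s p ds where sp: "b s = Some p" "fst p = Black" "\<forall>i. jstep_ok b s ds i"
      "Q = ((\<lambda>t. if t = s \<or> t \<in> range (jcap s ds) then None else b t), Red)" by blast
    then have "s = sq x y" using mover by blast
    then show ?thesis using infinite_jump_lost[OF b(2,3), of ds] sp by simp
  qed
qed

section \<open>Game values\<close>

lemma lost_val:
  assumes "lost_pos P" "Well_order a" "a \<noteq> {}"
  shows "val_le P a"
proof -
  obtain Q where "legal_move P Q" "won_for_red Q" using assms(1) by (auto simp: lost_pos_def)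
  moreover have "snd P = Red" using assms(1) by (simp add: lost_pos_def)
  moreover have "val_le Q {}" using calculation by (intro val_le.won) simp_all
  ultimately show ?thesis using val_le.red[OF assms(2)] empty_ordLess[OF assms(2,3)] by blast
qed

text \<open>Well-founded induction on the label. Any reply of Red to a safe stop at
  \<open>\<delta> < \<beta>\<close> leaves Black at label \<open>\<delta>\<close>, so that stop has
  value at most \<open>\<delta> + 1\<close>, hence at most \<open>\<beta>\<close>.\<close>

lemma black_pos_val: "black_pos P \<beta> \<Longrightarrow> val_le P \<beta>"
proof (induction \<beta> arbitrary: P rule: wf_induct_rule[OF wf_ordLess])
  case (1 \<beta>)
  have \<beta>: "Well_order \<beta>" "\<beta> \<noteq> {}" "snd P = Black"
    using 1(2) vlab_props by (auto simp: black_pos_def)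
  have "val_le Q \<beta>" if Q: "legal_move P Q" for Q
  proof -
    from black_legal[OF 1(2) Q] show ?thesis
    proof (elim disjE exE conjE)
      assume "lost_pos Q"
      then show ?thesis using lost_val \<beta> by blast
    next
      fix \<delta> assume \<delta>: "safe_pos Q \<delta>" "(\<delta>, \<beta>) \<in> ordLess"
      obtain R where R: "legal_move Q R" using safe_has_move[OF \<delta>(1)] by blast
      have "val_le R \<delta>" using 1(1)[OF \<delta>(2)] safe_legal[OF \<delta>(1) R] by blast
      moreover have "snd Q = Red" using \<delta>(1) by (auto simp: safe_pos_def)
      ultimately show ?thesis using val_le.red[OF \<beta>(1)] R \<delta>(2) by blast
    qed
  qed
  then show ?case using val_le.black \<beta> by blast
qed

lemma red_val_nonempty:
  assumes "val_le Q (a :: 'b rel)" "snd Q = Red"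
  shows "a \<noteq> {}"
  using assms(1)
proof cases
  case won
  then show ?thesis using assms(2) by (simp add: won_for_red_def)
next
  case (red R c)
  then show ?thesis using not_ordLess_empty[of c] by blast
next
  case black
  then show ?thesis using assms(2) by simp
qed

text \<open>Both bounds are proved together because the players alternate. If the bound
  \<open>a\<close> with Black to move were below the label, Black could stop at a label isomorphic
  to \<open>a\<close>, where the value exceeds \<open>a\<close>.\<close>

lemma val_lower:
  "val_le P (a :: 'b rel) \<Longrightarrow> (\<forall>\<beta>. black_pos P \<beta> \<longrightarrow> (\<beta>, a) \<in> ordLeq) \<and> (\<forall>\<beta>. safe_pos P \<beta> \<longrightarrow> (\<beta>, a) \<in> ordLess)"
proof (induction rule: val_le.induct)
  case (won a P)
  then have "\<not> black_pos P \<beta>" "\<not> safe_pos P \<beta>" for \<beta>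
    using black_has_move[of P \<beta>] by (auto simp: won_for_red_def safe_pos_def)
  then show ?case by blast
next
  case (red a P Q c)
  have "\<not> black_pos P \<beta>" for \<beta> using red(2) by (auto simp: black_pos_def)
  moreover have "(\<beta>, a) \<in> ordLess" if "safe_pos P \<beta>" for \<beta>
    using safe_legal[OF that red(3)] red(5,6) ordLeq_ordLess_trans by blast
  ultimately show ?case by blast
next
  case (black a P)
  have "\<not> safe_pos P \<beta>" for \<beta> using black(2) by (auto simp: safe_pos_def)
  moreover have "(\<beta>, a) \<in> ordLeq" if bp: "black_pos P \<beta>" for \<beta>
  proof (rule ccontr)
    assume "(\<beta>, a) \<notin> ordLeq"
    moreover have "Well_order \<beta>" using bp vlab_props by (auto simp: black_pos_def)
    ultimately have less: "(a, \<beta>) \<in> ordLess" using black(1) not_ordLeq_iff_ordLess by blast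
    \<comment> \<open>Black can exit only at nonempty labels. Here \<open>a\<close> is nonempty
      because it bounds a value with Red to move, which is a successor.\<close>
    have "a \<noteq> {}" using black_has_move[OF bp] black(3) red_val_nonempty by blast
    then obtain Q \<delta> where "legal_move P Q" "safe_pos Q \<delta>" "(\<delta>, a) \<in> ordIso"
      using black_reaches[OF bp _ less] by blast
    then show False using black(3) not_ordLess_ordIso by blast
  qed
  ultimately show ?case by blast
qed

section \<open>The starting position\<close>

definition start_board :: board where
  "start_board t = (if snd t \<ge> 0 then if t = sq 0 4 then bp else tree_board t
     else if snd t = -3 \<and> odd (fst t) \<or> snd t = -2 \<and> even (fst t) then rp
     else if snd t = -4 \<and> 4 dvd fst t then bp else None)"

lemma start_black_pos: "black_pos (start_board, Black) \<alpha>"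
proof -
  have "start_board (4*k, -4) = bp" for k by (simp add: start_board_def)
  then have "infinite {k. start_board (4*k, -4) = bp}" by (simp add: infinite_UNIV_char_0)
  then have "clock start_board"
    unfolding clock_def by (auto simp: start_board_def split: if_splits)
  then have "black_board start_board 0 4"
    unfolding black_board_def by (auto simp: start_board_def sq_def)
  moreover have "vertex 2 0 4" by (simp add: vertex_def)
  \<comment> \<open>The coordinate 0 of this node records no exit on either level below it, so the
    label is still that of the root.\<close>
  moreover have "vlab 2 0 4 = \<alpha>" by (simp add: vlab_def numeral_2_eq_2)
  ultimately show ?thesis unfolding black_pos_def by metis
qed

lemma start_valid: "valid_position (start_board, Black)"
proof -
  have tree: "dark t" if t: "tree_board t \<noteq> None" for t
  proof -
    obtain x y where "t = esq x y \<or> t = nsq x y" using t by (auto simp: tree_board_def split: if_splits)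
    then show ?thesis by (auto simp: dark_def esq_def nsq_def)
  qed
  have "dark t" if "start_board t \<noteq> None" for t
  proof -
    have "t = sq 0 4 \<or> tree_board t \<noteq> None \<or> snd t = -3 \<and> odd (fst t) \<or> snd t = -2 \<and> even (fst t)
      \<or> snd t = -4 \<and> 4 dvd fst t"
      using that unfolding start_board_def by argo
    moreover have "even (fst t)" if "4 dvd fst t" using that by presburger
    ultimately show ?thesis using tree[of t] by (auto simp: dark_def sq_def)
  qed
  then show ?thesis by (simp add: valid_position_def)
qed

end

text \<open>Decoding the index as a pair and using only its first component repeats every element
  infinitely often.\<close>

lemma countable_enum:
  assumes "countable S" "S \<noteq> {}"
  shows "\<exists>f :: nat \<Rightarrow> 'a. (\<forall>n. f n \<in> S) \<and> (\<forall>s\<in>S. \<forall>N. \<exists>n\<ge>N. f n = s)"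
proof -
  let ?f = "\<lambda>n. from_nat_into S (fst (prod_decode n))"
  have "?f n \<in> S" for n using from_nat_into[OF assms(2)] .
  moreover have "\<exists>n\<ge>N. ?f n = s" if s: "s \<in> S" for s N
  proof -
    obtain k where "from_nat_into S k = s" using from_nat_into_surj[OF assms(1) s] by blast
    then show ?thesis by (intro exI[of _ "prod_encode (k, N)"]) (simp add: le_prod_encode_2)
  qed
  ultimately show ?thesis by (intro exI[of _ ?f]) simp
qed

theorem theorem2:
  fixes \<alpha> :: "'b rel"
  assumes "Well_order \<alpha>" and "countable (Field \<alpha>)"
  shows "\<exists>P. valid_position P \<and> has_value P \<alpha>"
proof (cases "\<alpha> = {}")
  case True
  let ?P = "(\<lambda>_. None, Black) :: position"
  have "won_for_red ?P"
    by (simp add: won_for_red_def legal_move_def jump_available_def simple_move_def)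
  then have "val_le ?P \<alpha>" using assms(1) by (intro val_le.won)
  moreover have "(\<alpha>, c) \<in> ordLeq" if "val_le ?P c" for c :: "'b rel"
  proof -
    have "Well_order c" using that by cases auto
    then show ?thesis using True empty_ordLeq by simp
  qed
  ultimately show ?thesis unfolding has_value_def valid_position_def by (intro exI[of _ ?P]) simp
next
  case False
  define seg where "seg a = Restr \<alpha> (underS \<alpha> a)" for a
  \<comment> \<open>Including \<open>\<alpha>\<close> keeps \<open>S\<close> nonempty; labels never
    exceed \<open>\<alpha>\<close>, so this entry never opens an exit with a smaller label.\<close>
  define S where "S = insert \<alpha> (seg ` Field \<alpha> - {{}})"
  have "countable S" "S \<noteq> {}" using assms(2) by (simp_all add: S_def)
  from countable_enum[OF this] obtain \<gamma> :: "nat \<Rightarrow> 'b rel"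
    where \<gamma>: "\<forall>m. \<gamma> m \<in> S" "\<forall>s\<in>S. \<forall>N. \<exists>m\<ge>N. \<gamma> m = s"
    by (elim exE conjE) (rule that)
  have S: "Well_order s \<and> s \<noteq> {}" if "s \<in> S" for s
  proof -
    have "Well_order (seg a)" for a using Well_order_Restr[OF assms(1)] by (simp add: seg_def)
    moreover have "s = \<alpha> \<or> s \<in> range seg \<and> s \<noteq> {}" using that by (auto simp: S_def)
    ultimately show ?thesis using assms(1) False by (elim disjE conjE imageE) simp_all
  qed
  interpret ordinal_tree \<alpha> \<gamma>
  proof
    show "Well_order \<alpha>" "\<alpha> \<noteq> {}" using assms(1) False by auto
    show "Well_order (\<gamma> m)" "\<gamma> m \<noteq> {}" for m using S[of "\<gamma> m"] \<gamma>(1) by simp_all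
    show "\<exists>m\<ge>N. (\<gamma> m, c) \<in> ordIso" if c: "c \<noteq> {}" "(c, \<alpha>) \<in> ordLess" for c :: "'b rel" and N
    proof -
      have "Well_order c" using c(2) by (simp add: ordLess_def)
      then obtain a where a: "a \<in> Field \<alpha>" "(c, seg a) \<in> ordIso"
        using ordLess_iff_ordIso_Restr[OF assms(1), of c] c(2) by (auto simp: seg_def)
      then have "seg a \<in> S" using ordIso_empty_iff[OF a(2)] c(1) by (simp add: S_def)
      then obtain m where "m \<ge> N" "\<gamma> m = seg a" using \<gamma>(2) by blast
      then show ?thesis using ordIso_symmetric[OF a(2)] by auto
    qed
  qed
  have "has_value (start_board, Black) \<alpha>"
    unfolding has_value_def using black_pos_val val_lower start_black_pos by blast
  then show ?thesis using start_valid by blast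
qed

end
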